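(* Let $k\ge 1$ be a real number, and let $\{\alpha_n\}_{n\ge 0}$ and $\{\phi_n\}_{n\ge 0}$ be sequences of positive numbers. Let $A=(a_{nv})_{n,v\ge 0}$ be a lower triangular matrix with $a_{nn}\neq 0$ for all $n$, belonging to the class $\mathcal{S}(\alpha_n,\phi_n)$ (for this $k$), and set $X_n=\phi_n/a_{nn}$ for $n\ge 0$. Let $\{\lambda_n\}_{n\ge 0}$ be a sequence of complex numbers of bounded variation, $\{\lambda_n\}\in BV$, such that $\lambda_{n+1}=O(|\lambda_n|)$ for $n=1,2,\dots$, and suppose that (A) $\sum_{n=0}^{\infty}\alpha_n\phi_n^{k}|X_n|^{k}|\lambda_n|^{k}<\infty$, (B) $\sum_{n=0}^{\infty}\alpha_n\phi_n^{k-1}|X_n|^{k}|\Delta\lambda_n|<\infty$. Suppose moreover that $$\sum_{v=0}^{n}\left|a_{vv}\,\widehat{a}_{n,v+1}\right|=O(\phi_n)\qquad\text{and}\qquad \Delta X_n=O(\phi_n).$$ Then the summability $|A,\alpha_n|_k$ of the series $\sum C_n(t)\lambda_nX_n$ at any point is a local property of $f$.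
   Context: Differences: $\Delta u_n=u_n-u_{n+1}$ and $\Delta_i\widehat a_{ni}=\widehat a_{ni}-\widehat a_{n,i+1}$ (only absolute values of these are used). $\{\lambda_n\}\in BV$ means $\sum_{n=1}^\infty|\Delta\lambda_n|<\infty$. All $O$-constants are uniform in the free indices. Associated matrices: for a lower triangular matrix $A=(a_{nv})_{n,v\ge0}$, put $\overline a_{nv}=\sum_{r=v}^{n}a_{nr}$ for $0\le v\le n$, $\widehat a_{nv}=\overline a_{nv}-\overline a_{n-1,v}$ for $0\le v\le n-1$, $n\ge1$, and $\widehat a_{nn}=a_{nn}$; entries above the diagonal are $0$ (in particular $\widehat a_{n,n+1}=0$). Summability: for a nonnegative sequence $\{\alpha_n\}$ and $k\ge1$, a series $\sum u_n$ with partial sums $s_n$ is summable $|A,\alpha_n|_k$ if $\sum_{n=1}^\infty\alpha_n|A_n-A_{n-1}|^k<\infty$, where $A_n=\sum_{v=1}^n a_{nv}s_v$ (the series considered here have zero $0$th term, so $s_0=0$ and $A_0=0$). Class $\mathcal S(\alpha_n,\phi_n)$ (for fixed $k\ge 1$): a lower triangular matrix $A$ belongs to $\mathcal{S}(\alpha_n,\phi_n)$ if (T1) $\sum_{i=0}^{n-1}|\Delta_i\widehat a_{ni}|=O(\phi_n)$; (T2) $|\widehat a_{ni}|=O(\phi_n)$ for $i=0,1,\dots,n$; (T3) $\sum_{n=i+1}^\infty\alpha_n\phi_n^{k-1}|\Delta_i\widehat a_{ni}|=O(\alpha_i\phi_i^k)$; (T4) $\sum_{n=i+1}^\infty\alpha_n\phi_n^{k-1}|\widehat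 a_{n,i+1}|=O(\alpha_i\phi_i^{k-1})$. Fourier series: $f$ is a $2\pi$-periodic function, Lebesgue integrable over $(-\pi,\pi)$, with $\int_{-\pi}^{\pi}f(t)\,dt=0$, and Fourier series $f(t)\sim\sum_{n=1}^\infty(a_n\cos nt+b_n\sin nt)\equiv\sum_{n=1}^\infty C_n(t)$. Local property: the summability of the factored series at $t=x$ is a local property of $f$ if it depends only on the behaviour of $f$ in an arbitrarily small neighbourhood of $x$; i.e. if two such functions $f,g$ coincide in some neighbourhood of $x$, then the series built from $f$ is summable at $x$ if and only if the one built from $g$ is. *)

theory Defs
  imports "HOL-Analysis.Analysis"
begin

definition fdiff :: "(nat \<Rightarrow> complex) \<Rightarrow> nat \<Rightarrow> complex" where
  "fdiff u n = u n - u (Suc n)"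

definition bounded_variation_seq :: "(nat \<Rightarrow> complex) \<Rightarrow> bool" where
  "bounded_variation_seq u \<longleftrightarrow> summable (\<lambda>n. norm (fdiff u (Suc n)))"

definition lower_triangular :: "(nat \<Rightarrow> nat \<Rightarrow> complex) \<Rightarrow> bool" where
  "lower_triangular A \<longleftrightarrow> (\<forall>n v. n < v \<longrightarrow> A n v = 0)"

definition bar_mat :: "(nat \<Rightarrow> nat \<Rightarrow> complex) \<Rightarrow> nat \<Rightarrow> nat \<Rightarrow> complex" where
  "bar_mat A n v = (\<Sum>r=v..n. A n r)"

definition hat_mat :: "(nat \<Rightarrow> nat \<Rightarrow> complex) \<Rightarrow> nat \<Rightarrow> nat \<Rightarrow> complex" where
  "hat_mat A n v =
     (if v < n then bar_mat A n v - bar_mat A (n - 1) v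
      else if v = n then A n n
      else 0)"

(* Series are indexed from 1: the value u 0 is ignored. *)
definition partial_sum :: "(nat \<Rightarrow> complex) \<Rightarrow> nat \<Rightarrow> complex" where
  "partial_sum u n = (\<Sum>v=1..n. u v)"

definition matrix_mean ::
    "(nat \<Rightarrow> nat \<Rightarrow> complex) \<Rightarrow> (nat \<Rightarrow> complex) \<Rightarrow> nat \<Rightarrow> complex" where
  "matrix_mean A u n = (\<Sum>v=1..n. A n v * partial_sum u v)"

(* Summability |A, alpha_n|_k of the series of the u n, n >= 1; the n-th term below is
   the one of index n + 1 in the usual notation. *)
definition abs_matrix_summable ::
    "(nat \<Rightarrow> nat \<Rightarrow> complex) \<Rightarrow> (nat \<Rightarrow> real) \<Rightarrow> real \<Rightarrow> (nat \<Rightarrow> complex) \<Rightarrow> bool" where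
  "abs_matrix_summable A \<alpha> k u \<longleftrightarrow>
     summable (\<lambda>n. \<alpha> (Suc n) * norm (matrix_mean A u (Suc n) - matrix_mean A u n) powr k)"

(* The class S(alpha_n, phi_n) for the exponent k. Sums over n >= i + 1 are reindexed by
   n = m + i + 1. Their convergence has to be required separately, since suminf of a
   divergent series is an unspecified real number. *)
definition class_S ::
    "real \<Rightarrow> (nat \<Rightarrow> real) \<Rightarrow> (nat \<Rightarrow> real) \<Rightarrow> (nat \<Rightarrow> nat \<Rightarrow> complex) set" where
  "class_S k \<alpha> \<phi> = {A. lower_triangular A \<and>
     (\<exists>C. \<forall>n. (\<Sum>i<n. norm (fdiff (hat_mat A n) i)) \<le> C * \<phi> n) \<and>
     (\<exists>C. \<forall>n. \<forall>i\<le>n. norm (hat_mat A n i) \<le> C * \<phi> n) \<and>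
     (\<exists>C. \<forall>i.
        summable (\<lambda>m. \<alpha> (m + i + 1) * \<phi> (m + i + 1) powr (k - 1)
                        * norm (fdiff (hat_mat A (m + i + 1)) i)) \<and>
        (\<Sum>m. \<alpha> (m + i + 1) * \<phi> (m + i + 1) powr (k - 1)
                        * norm (fdiff (hat_mat A (m + i + 1)) i))
          \<le> C * (\<alpha> i * \<phi> i powr k)) \<and>
     (\<exists>C. \<forall>i.
        summable (\<lambda>m. \<alpha> (m + i + 1) * \<phi> (m + i + 1) powr (k - 1)
                        * norm (hat_mat A (m + i + 1) (i + 1))) \<and>
        (\<Sum>m. \<alpha> (m + i + 1) * \<phi> (m + i + 1) powr (k - 1)
                        * norm (hat_mat A (m + i + 1) (i + 1)))
          \<le> C * (\<alpha> i * \<phi> i powr (k - 1)))}"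

definition admissible :: "(real \<Rightarrow> complex) \<Rightarrow> bool" where
  "admissible f \<longleftrightarrow>
     (\<forall>t. f (t + 2 * pi) = f t) \<and>
     set_integrable lebesgue {-pi<..<pi} f \<and>
     (LINT t:{-pi<..<pi}|lebesgue. f t) = 0"

definition fourier_cos_coeff :: "(real \<Rightarrow> complex) \<Rightarrow> nat \<Rightarrow> complex" where
  "fourier_cos_coeff f n =
     (LINT t:{-pi<..<pi}|lebesgue. f t * complex_of_real (cos (real n * t))) / complex_of_real pi"

definition fourier_sin_coeff :: "(real \<Rightarrow> complex) \<Rightarrow> nat \<Rightarrow> complex" where
  "fourier_sin_coeff f n =
     (LINT t:{-pi<..<pi}|lebesgue. f t * complex_of_real (sin (real n * t))) / complex_of_real pi"

(* C_n(t), used for n >= 1 only. *)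
definition fourier_term :: "(real \<Rightarrow> complex) \<Rightarrow> nat \<Rightarrow> real \<Rightarrow> complex" where
  "fourier_term f n t =
     fourier_cos_coeff f n * complex_of_real (cos (real n * t))
     + fourier_sin_coeff f n * complex_of_real (sin (real n * t))"

definition local_property_at :: "real \<Rightarrow> ((real \<Rightarrow> complex) \<Rightarrow> bool) \<Rightarrow> bool" where
  "local_property_at x P \<longleftrightarrow>
     (\<forall>f g. admissible f \<and> admissible g \<and> (\<forall>\<^sub>F t in nhds x. f t = g t)
        \<longrightarrow> (P f \<longleftrightarrow> P g))"

end

theory Submission
  imports Defs
begin

text \<open>
  The difference \<open>h = f - g\<close> of two functions that agree near \<open>x\<close> vanishes near \<open>x\<close>. The partial
  sums of its Fourier series at \<open>x\<close> are integrals of \<open>h\<close> against the cosine sums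
  \<open>\<Sum>v=1..n. cos (v * (t - x))\<close>, and these are at most \<open>1 / \<bar>sin ((t - x) / 2)\<bar>\<close>, uniformly in \<open>n\<close>.
  This bound blows up only at \<open>x\<close> and its translates by periods, where \<open>h\<close> vanishes. So the
  partial sums stay bounded (\<open>fourier_partial_sums_bounded\<close>).

  Boundedness of the partial sums \<open>s\<^sub>i\<close> of a series \<open>\<Sum> u\<^sub>i\<close> makes the factored series \<open>\<Sum> u\<^sub>i \<lambda>\<^sub>i X\<^sub>i\<close> summable
  (\<open>abs_matrix_summable_of_bounded_partial_sums\<close>). Indeed its mean
  differences are \<open>\<Sum>i=1..n. a\<^sub>n\<^sub>i u\<^sub>i \<lambda>\<^sub>i X\<^sub>i\<close> with \<open>a\<^sub>n\<^sub>i\<close> the entries of the hat matrix, and summation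
  by parts turns this into four pieces: a diagonal term and the sums over \<open>i < n\<close> of
  \<open>(\<Delta>\<^sub>i a\<^sub>n\<^sub>i) \<lambda>\<^sub>i X\<^sub>i s\<^sub>i\<close>, \<open>a\<^sub>n\<^sub>,\<^sub>i\<^sub>+\<^sub>1 (\<Delta>\<lambda>\<^sub>i) X\<^sub>i s\<^sub>i\<close> and \<open>a\<^sub>n\<^sub>,\<^sub>i\<^sub>+\<^sub>1 \<lambda>\<^sub>i\<^sub>+\<^sub>1 (\<Delta>X\<^sub>i) s\<^sub>i\<close>. Each sum is a
  transform of a fixed sequence by a nonnegative matrix whose \<open>n\<close>-th row sum is \<open>O(\<phi>\<^sub>n)\<close> and whose
  weighted column sums are controlled by the two column conditions of \<open>class_S\<close>. For such
  transforms Hoelder's inequality in the rows and an interchange of summations give a finite bound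
  (\<open>summable_weighted_transform\<close>): the series assumed to converge that has the factor \<open>\<bar>\<Delta>\<lambda>\<^sub>i\<bar>\<close>
  bounds the second sum, and the one with the factor \<open>\<bar>\<lambda>\<^sub>i\<bar> powr k\<close> bounds the first and the third.
  The latter also covers the diagonal term, because \<open>\<bar>X\<^sub>n\<bar>\<close> is bounded below: the entry bound in
  \<open>class_S\<close>, taken on the diagonal, says that \<open>\<bar>A n n\<bar> = O(\<phi>\<^sub>n)\<close>.

  Since the means are linear in the series and summability is preserved under differences, the
  series of \<open>f\<close> and that of \<open>g\<close> are summable together.
\<close>

section \<open>Weighted power sums\<close>

text \<open>
  Hoelder's inequality for the weights \<open>w\<close>, obtained as Jensen's inequality for \<open>t powr k\<close> with the
  weights normalised to sum \<open>1\<close>.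
\<close>

lemma weighted_power_mean:
  fixes w z :: "'a \<Rightarrow> real"
  assumes k: "k \<ge> 1" and S: "finite S"
    and w: "\<And>i. i \<in> S \<Longrightarrow> w i \<ge> 0" and z: "\<And>i. i \<in> S \<Longrightarrow> z i \<ge> 0"
  shows "(\<Sum>i\<in>S. w i * z i) powr k \<le> (\<Sum>i\<in>S. w i) powr (k - 1) * (\<Sum>i\<in>S. w i * z i powr k)"
proof -
  \<comment> \<open>Dropping the indices that contribute nothing leaves weights with a positive sum, which can be
    normalised, and points in the open half line, where the power is convex.\<close>
  define P where "P = {i\<in>S. w i > 0 \<and> z i > 0}"
  define W where "W = (\<Sum>i\<in>P. w i)"
  have P: "finite P" "P \<subseteq> S" "\<And>i. i \<in> P \<Longrightarrow> w i > 0 \<and> z i > 0"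
    using S by (auto simp: P_def)
  have restrict: "(\<Sum>i\<in>S. w i * z i) = (\<Sum>i\<in>P. w i * z i)"
    using w z by (intro sum.mono_neutral_right[OF S P(2)]) (force simp: P_def)
  have rhs_nonneg: "0 \<le> (\<Sum>i\<in>S. w i * z i powr k)"
    using w by (intro sum_nonneg) auto
  show ?thesis
  proof (cases "P = {}")
    case True
    then show ?thesis
      using restrict rhs_nonneg k by simp
  next
    case False
    have W: "W > 0"
      unfolding W_def using P False by (intro sum_pos) auto
    have "(\<Sum>i\<in>P. (w i / W) *\<^sub>R z i) powr k \<le> (\<Sum>i\<in>P. (w i / W) * z i powr k)"
    proof (rule convex_on_sum[OF P(1) False powr_convex[OF k]])
      show "(\<Sum>i\<in>P. w i / W) = 1"
        using W by (simp add: W_def flip: sum_divide_distrib)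
    qed (use P W in \<open>auto simp: less_imp_le\<close>)
    then have jensen: "((\<Sum>i\<in>P. w i * z i) / W) powr k \<le> (\<Sum>i\<in>P. w i * z i powr k) / W"
      by (simp add: sum_divide_distrib)
    have "(\<Sum>i\<in>P. w i * z i) powr k = W powr k * ((\<Sum>i\<in>P. w i * z i) / W) powr k"
    proof -
      have "0 \<le> (\<Sum>i\<in>P. w i * z i)"
        using P by (intro sum_nonneg) (auto simp: less_imp_le)
      then show ?thesis
        using W by (simp flip: powr_mult)
    qed
    also have "\<dots> \<le> W powr k * ((\<Sum>i\<in>P. w i * z i powr k) / W)"
      using jensen by (intro mult_left_mono) auto
    also have "\<dots> = W powr (k - 1) * (\<Sum>i\<in>P. w i * z i powr k)"
      using W by (simp add: powr_diff)
    also have "\<dots> \<le> (\<Sum>i\<in>S. w i) powr (k - 1) * (\<Sum>i\<in>S. w i * z i powr k)"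
    proof (intro mult_mono powr_mono2)
      show "W \<le> (\<Sum>i\<in>S. w i)"
        unfolding W_def by (intro sum_mono2 S P(2)) (use w in auto)
      show "(\<Sum>i\<in>P. w i * z i powr k) \<le> (\<Sum>i\<in>S. w i * z i powr k)"
        by (intro sum_mono2 S P(2)) (use w in auto)
    qed (use k W P rhs_nonneg in \<open>auto intro!: sum_nonneg simp: less_imp_le\<close>)
    finally show ?thesis
      unfolding restrict .
  qed
qed

text \<open>
  This is the estimate behind each of the three sums that come from summation by parts. In row \<open>n\<close>,
  Hoelder's inequality costs a factor \<open>(C * \<phi> n) powr (k - 1)\<close> and moves the power inside the sum;
  after the interchange of summations the part \<open>\<phi> n powr (k - 1)\<close> of that factor completes the weight
  in the column condition, so column \<open>i\<close> contributes \<open>\<gamma> i * z i powr k\<close> up to a constant.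
\<close>

lemma summable_weighted_transform:
  fixes \<alpha> \<phi> \<gamma> z :: "nat \<Rightarrow> real" and w :: "nat \<Rightarrow> nat \<Rightarrow> real"
  assumes k: "k \<ge> 1" and \<alpha>: "\<And>n. \<alpha> n > 0" and \<phi>: "\<And>n. \<phi> n > 0"
    and w: "\<And>n i. w n i \<ge> 0" and z: "\<And>i. z i \<ge> 0"
    and rows: "\<And>n. (\<Sum>i<n. w n i) \<le> C * \<phi> n"
    and columns: "\<And>i. summable (\<lambda>m. \<alpha> (m + i + 1) * \<phi> (m + i + 1) powr (k - 1) * w (m + i + 1) i)"
      "\<And>i. (\<Sum>m. \<alpha> (m + i + 1) * \<phi> (m + i + 1) powr (k - 1) * w (m + i + 1) i) \<le> \<gamma> i"
    and summ: "summable (\<lambda>i. \<gamma> i * z i powr k)"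
  shows "summable (\<lambda>n. \<alpha> n * (\<Sum>i<n. w n i * z i) powr k)"
proof (rule summableI_nonneg_bounded)
  define b where "b n i = \<alpha> n * \<phi> n powr (k - 1) * w n i" for n i
  have b: "b n i \<ge> 0" for n i
    using \<alpha> w by (simp add: b_def less_imp_le)
  have C: "C \<ge> 0"
    using rows[of 0] \<phi>[of 0] by (simp add: zero_le_mult_iff)
  have column: "(\<Sum>n\<in>{i+1..<N}. b n i) \<le> \<gamma> i" if "i < N" for i N
  proof -
    have "(\<Sum>n\<in>{i+1..<N}. b n i) = (\<Sum>m<N - (i + 1). b (m + i + 1) i)"
      by (rule sum.reindex_bij_witness[of _ "\<lambda>m. m + i + 1" "\<lambda>n. n - (i + 1)"]) auto
    also have "\<dots> \<le> (\<Sum>m. b (m + i + 1) i)"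
      using columns(1)[of i] b by (intro sum_le_suminf) (auto simp: b_def)
    also have "\<dots> \<le> \<gamma> i"
      using columns(2)[of i] by (simp add: b_def)
    finally show ?thesis .
  qed
  have \<gamma>: "\<gamma> i \<ge> 0" for i
    using column[of i "i + 1"] by simp
  fix N
  have "(\<Sum>n<N. \<alpha> n * (\<Sum>i<n. w n i * z i) powr k)
      \<le> (\<Sum>n<N. C powr (k - 1) * (\<Sum>i<n. b n i * z i powr k))"
  proof (rule sum_mono)
    fix n
    have "(\<Sum>i<n. w n i * z i) powr k
        \<le> (\<Sum>i<n. w n i) powr (k - 1) * (\<Sum>i<n. w n i * z i powr k)"
      by (rule weighted_power_mean) (use k w z in auto)
    also have "\<dots> \<le> (C * \<phi> n) powr (k - 1) * (\<Sum>i<n. w n i * z i powr k)"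
      using rows[of n] w k by (intro mult_right_mono powr_mono2 sum_nonneg) auto
    also have "\<dots> = C powr (k - 1) * (\<phi> n powr (k - 1) * (\<Sum>i<n. w n i * z i powr k))"
      using C \<phi>[of n] by (simp add: powr_mult)
    finally have "\<alpha> n * (\<Sum>i<n. w n i * z i) powr k
        \<le> \<alpha> n * (C powr (k - 1) * (\<phi> n powr (k - 1) * (\<Sum>i<n. w n i * z i powr k)))"
      using \<alpha>[of n] by (intro mult_left_mono) auto
    then show "\<alpha> n * (\<Sum>i<n. w n i * z i) powr k \<le> C powr (k - 1) * (\<Sum>i<n. b n i * z i powr k)"
      by (simp add: b_def sum_distrib_left mult_ac)
  qed
  also have "\<dots> = C powr (k - 1) * (\<Sum>n<N. \<Sum>i<n. b n i * z i powr k)"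
    by (simp add: sum_distrib_left)
  also have "(\<Sum>n<N. \<Sum>i<n. b n i * z i powr k) = (\<Sum>i<N. \<Sum>n\<in>{i+1..<N}. b n i * z i powr k)"
    unfolding sum.Sigma[OF finite_lessThan ballI[OF finite_lessThan]]
      sum.Sigma[OF finite_lessThan ballI[OF finite_atLeastLessThan]]
    by (rule sum.reindex_bij_witness[of _ "\<lambda>(i, n). (n, i)" "\<lambda>(n, i). (i, n)"]) auto
  also have "\<dots> \<le> (\<Sum>i<N. \<gamma> i * z i powr k)"
    using column by (intro sum_mono) (auto simp flip: sum_distrib_right intro!: mult_right_mono)
  also have "\<dots> \<le> (\<Sum>i. \<gamma> i * z i powr k)"
    using \<gamma> by (intro sum_le_suminf summ) auto
  finally show "(\<Sum>n<N. \<alpha> n * (\<Sum>i<n. w n i * z i) powr k)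
      \<le> C powr (k - 1) * (\<Sum>i. \<gamma> i * z i powr k)"
    by (simp add: mult_left_mono)
next
  show "0 \<le> \<alpha> n * (\<Sum>i<n. w n i * z i) powr k" for n
    using \<alpha>[of n] by simp
qed

lemma summable_powr_add:
  fixes \<alpha> x y :: "nat \<Rightarrow> real"
  assumes k: "k \<ge> 1" and \<alpha>: "\<And>n. \<alpha> n > 0" and x: "\<And>n. x n \<ge> 0" and y: "\<And>n. y n \<ge> 0"
    and summ: "summable (\<lambda>n. \<alpha> n * x n powr k)" "summable (\<lambda>n. \<alpha> n * y n powr k)"
  shows "summable (\<lambda>n. \<alpha> n * (x n + y n) powr k)"
proof (rule summable_comparison_test')
  show "summable (\<lambda>n. 2 powr k * (\<alpha> n * x n powr k + \<alpha> n * y n powr k))"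
    by (intro summable_mult summable_add summ)
  fix n
  have "(x n + y n) powr k \<le> (2 * max (x n) (y n)) powr k"
    using x[of n] y[of n] k by (intro powr_mono2) auto
  also have "\<dots> = 2 powr k * max (x n) (y n) powr k"
    using x[of n] by (simp add: powr_mult)
  also have "\<dots> \<le> 2 powr k * (x n powr k + y n powr k)"
    by (intro mult_left_mono) (auto simp: max_def)
  finally have "\<alpha> n * (x n + y n) powr k \<le> \<alpha> n * (2 powr k * (x n powr k + y n powr k))"
    using \<alpha>[of n] by (intro mult_left_mono) auto
  then show "norm (\<alpha> n * (x n + y n) powr k) \<le> 2 powr k * (\<alpha> n * x n powr k + \<alpha> n * y n powr k)"
    using \<alpha>[of n] by (simp add: algebra_simps)
qed

lemma summable_powr_dominated:
  fixes \<alpha> x y :: "nat \<Rightarrow> real"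
  assumes k: "k \<ge> 1" and \<alpha>: "\<And>n. \<alpha> n > 0" and x: "\<And>n. x n \<ge> 0"
    and dom: "\<And>n. x n \<le> M * y n" and y: "\<And>n. y n \<ge> 0" and M: "M \<ge> 0"
    and summ: "summable (\<lambda>n. \<alpha> n * y n powr k)"
  shows "summable (\<lambda>n. \<alpha> n * x n powr k)"
proof (rule summable_comparison_test')
  show "summable (\<lambda>n. M powr k * (\<alpha> n * y n powr k))"
    by (intro summable_mult summ)
  fix n
  have "x n powr k \<le> (M * y n) powr k"
    using x dom k by (intro powr_mono2) auto
  then have "\<alpha> n * x n powr k \<le> \<alpha> n * (M powr k * y n powr k)"
    using \<alpha>[of n] M y by (intro mult_left_mono) (auto simp: powr_mult)
  then show "norm (\<alpha> n * x n powr k) \<le> M powr k * (\<alpha> n * y n powr k)"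
    using \<alpha>[of n] by (simp add: mult_ac)
qed

section \<open>Matrix means\<close>

lemma matrix_mean_bar_mat:
  "matrix_mean A u n = (\<Sum>i=1..n. bar_mat A n i * u i)"
proof -
  have "matrix_mean A u n = (\<Sum>v=1..n. \<Sum>i=1..v. A n v * u i)"
    by (simp add: matrix_mean_def partial_sum_def sum_distrib_left)
  also have "\<dots> = (\<Sum>i=1..n. \<Sum>v=i..n. A n v * u i)"
    unfolding sum.Sigma[OF finite_atLeastAtMost ballI[OF finite_atLeastAtMost]]
    by (rule sum.reindex_bij_witness[of _ "\<lambda>(i, n). (n, i)" "\<lambda>(n, i). (i, n)"]) auto
  finally show ?thesis
    by (simp add: bar_mat_def sum_distrib_right)
qed

text \<open>
  The hat matrix maps the terms of a series to the successive differences of its means.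
\<close>

lemma matrix_mean_diff:
  "matrix_mean A u (Suc n) - matrix_mean A u n = (\<Sum>i=1..Suc n. hat_mat A (Suc n) i * u i)"
proof -
  have "(\<Sum>i=1..n. hat_mat A (Suc n) i * u i)
      = (\<Sum>i=1..n. bar_mat A (Suc n) i * u i) - (\<Sum>i=1..n. bar_mat A n i * u i)"
    by (simp add: hat_mat_def algebra_simps flip: sum_subtractf)
  then show ?thesis
    by (simp add: matrix_mean_bar_mat hat_mat_def bar_mat_def)
qed

lemma matrix_mean_diff_terms:
  "matrix_mean A (\<lambda>n. u n - v n) n = matrix_mean A u n - matrix_mean A v n"
  by (simp add: matrix_mean_bar_mat algebra_simps flip: sum_subtractf)

lemma summation_by_parts:
  "(\<Sum>i=1..Suc n. b i * u i)
     = (\<Sum>i=1..<Suc n. fdiff b i * partial_sum u i) + b (Suc n) * partial_sum u (Suc n)"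
  by (induction n) (auto simp: fdiff_def partial_sum_def algebra_simps)

text \<open>
  This form of the product rule fixes the three sums to be estimated: the second factor \<open>l\<close> is
  shifted only where \<open>x\<close> is differenced, which is where the growth condition on \<open>lam\<close> enters.
\<close>

lemma fdiff_triple_product:
  "fdiff (\<lambda>i. a i * (l i * x i)) i
     = fdiff a i * (l i * x i) + a (Suc i) * fdiff l i * x i + a (Suc i) * l (Suc i) * fdiff x i"
  by (simp add: fdiff_def algebra_simps)

lemma abs_matrix_summable_diff:
  assumes k: "k \<ge> 1" and \<alpha>: "\<And>n. \<alpha> n > 0"
    and "abs_matrix_summable A \<alpha> k u" "abs_matrix_summable A \<alpha> k v"
  shows "abs_matrix_summable A \<alpha> k (\<lambda>n. u n - v n)"
  unfolding abs_matrix_summable_def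
proof (rule summable_powr_dominated[where M = 1])
  show "summable (\<lambda>n. \<alpha> (Suc n) *
      (norm (matrix_mean A u (Suc n) - matrix_mean A u n)
       + norm (matrix_mean A v (Suc n) - matrix_mean A v n)) powr k)"
    using assms by (intro summable_powr_add) (auto simp: abs_matrix_summable_def)
  show "norm (matrix_mean A (\<lambda>n. u n - v n) (Suc n) - matrix_mean A (\<lambda>n. u n - v n) n)
      \<le> 1 * (norm (matrix_mean A u (Suc n) - matrix_mean A u n)
       + norm (matrix_mean A v (Suc n) - matrix_mean A v n))" for n
    unfolding matrix_mean_diff_terms
    using norm_triangle_ineq4[of "matrix_mean A u (Suc n) - matrix_mean A u n"
        "matrix_mean A v (Suc n) - matrix_mean A v n"]
    by (simp add: algebra_simps)
qed (use k \<alpha> in auto)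

text \<open>
  The sums \<open>p1\<close>, \<open>p2\<close> and \<open>p3\<close> in the proof correspond to the three terms of
  \<open>fdiff_triple_product\<close>, and \<open>p4\<close> to the diagonal term. In \<open>p3\<close>, the bound \<open>O(\<phi> i)\<close> of the
  differences of \<open>X\<close> is written as \<open>\<bar>A i i\<bar> * \<bar>X i\<bar>\<close>: one factor makes the weights
  \<open>\<bar>A i i * a n (i + 1)\<bar>\<close>, whose row sums are under control, and the other makes
  \<open>\<bar>lam i * X i\<bar>\<close>, to which \<open>condA\<close> applies. In \<open>p2\<close> it is the bounded variation of \<open>lam\<close> that bounds
  the row sums.
\<close>

lemma abs_matrix_summable_of_bounded_partial_sums:
  fixes k :: real
    and \<alpha> \<phi> :: "nat \<Rightarrow> real"
    and A :: "nat \<Rightarrow> nat \<Rightarrow> complex"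
    and X lam :: "nat \<Rightarrow> complex"
  assumes k: "k \<ge> 1"
    and \<alpha>: "\<And>n. \<alpha> n > 0"
    and \<phi>: "\<And>n. \<phi> n > 0"
    and diag: "\<And>n. A n n \<noteq> 0"
    and A: "A \<in> class_S k \<alpha> \<phi>"
    and X: "\<And>n. X n = complex_of_real (\<phi> n) / A n n"
    and BV: "bounded_variation_seq lam"
    and lam: "\<exists>C. \<forall>n\<ge>1. norm (lam (n + 1)) \<le> C * norm (lam n)"
    and condA: "summable (\<lambda>n. \<alpha> n * \<phi> n powr k * norm (X n) powr k * norm (lam n) powr k)"
    and condB: "summable (\<lambda>n. \<alpha> n * \<phi> n powr (k - 1) * norm (X n) powr k * norm (fdiff lam n))"
    and diag_hat: "\<exists>C. \<forall>n. (\<Sum>v=0..n. norm (A v v * hat_mat A n (v + 1))) \<le> C * \<phi> n"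
    and fdiff_X: "\<exists>C. \<forall>n. norm (fdiff X n) \<le> C * \<phi> n"
    and bounded: "\<And>n. norm (partial_sum u n) \<le> M"
  shows "abs_matrix_summable A \<alpha> k (\<lambda>n. u n * lam n * X n)"
proof -
  define a where "a = hat_mat A"
  define \<beta> where "\<beta> n = \<alpha> n * \<phi> n powr (k - 1)" for n
  obtain C1 where T1: "\<And>n. (\<Sum>i<n. norm (fdiff (a n) i)) \<le> C1 * \<phi> n"
    using A by (auto simp: class_S_def a_def)
  obtain C2 where T2: "\<And>n i. i \<le> n \<Longrightarrow> norm (a n i) \<le> C2 * \<phi> n"
    using A by (auto simp: class_S_def a_def)
  obtain C3 where T3: "\<And>i. summable (\<lambda>m. \<beta> (m + i + 1) * norm (fdiff (a (m + i + 1)) i))"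
      "\<And>i. (\<Sum>m. \<beta> (m + i + 1) * norm (fdiff (a (m + i + 1)) i)) \<le> C3 * (\<alpha> i * \<phi> i powr k)"
    using A unfolding class_S_def a_def \<beta>_def by blast
  obtain C4 where T4: "\<And>i. summable (\<lambda>m. \<beta> (m + i + 1) * norm (a (m + i + 1) (i + 1)))"
      "\<And>i. (\<Sum>m. \<beta> (m + i + 1) * norm (a (m + i + 1) (i + 1))) \<le> C4 * (\<alpha> i * \<phi> i powr (k - 1))"
    using A unfolding class_S_def a_def \<beta>_def by blast
  obtain C5 where C5: "\<And>n. n \<ge> 1 \<Longrightarrow> norm (lam (n + 1)) \<le> C5 * norm (lam n)"
    using lam by blast
  obtain C6 where C6: "\<And>n. (\<Sum>v=0..n. norm (A v v * a n (v + 1))) \<le> C6 * \<phi> n"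
    using diag_hat by (auto simp: a_def)
  obtain C7 where C7: "\<And>n. norm (fdiff X n) \<le> C7 * \<phi> n"
    using fdiff_X by blast

  have \<beta>: "\<beta> n > 0" for n
    using \<alpha>[of n] \<phi>[of n] by (simp add: \<beta>_def)
  have \<beta>_\<phi>: "\<beta> n * \<phi> n = \<alpha> n * \<phi> n powr k" for n
    using \<phi>[of n] by (simp add: \<beta>_def powr_diff)
  have C2: "C2 \<ge> 0"
    using order_trans[OF norm_ge_zero T2[of 0 0]] \<phi>[of 0] by (simp add: zero_le_mult_iff)
  have C4: "C4 \<ge> 0"
  proof -
    have "0 \<le> C4 * \<beta> 0"
      using order_trans[OF suminf_nonneg[OF T4(1)[of 0]] T4(2)[of 0]] \<beta>
      by (simp add: \<beta>_def less_imp_le)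
    then show ?thesis
      using \<beta>[of 0] by (simp add: zero_le_mult_iff)
  qed
  have C7_nonneg: "C7 \<ge> 0"
    using order_trans[OF norm_ge_zero C7[of 0]] \<phi>[of 0] by (simp add: zero_le_mult_iff)
  have M: "M \<ge> 0"
    using bounded[of 0] norm_ge_zero order_trans by blast
  have AX: "norm (A n n) * norm (X n) = \<phi> n" for n
    using \<phi>[of n] diag[of n] by (simp add: X norm_divide)
  have diag_le: "norm (A n n) \<le> C2 * \<phi> n" for n
    using T2[of n n] by (simp add: a_def hat_mat_def)
  have X_below: "1 \<le> C2 * norm (X n)" for n
  proof -
    have "\<phi> n \<le> C2 * \<phi> n * norm (X n)"
      using mult_right_mono[OF diag_le[of n] norm_ge_zero[of "X n"]] AX[of n] by simp
    then show ?thesis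
      using \<phi>[of n] by (simp add: mult.commute mult.left_commute)
  qed
  have condA': "summable (\<lambda>i. \<alpha> i * \<phi> i powr k * norm (lam i * X i) powr k)"
    using condA by (simp add: norm_mult powr_mult mult_ac)

  define p1 where "p1 n = (\<Sum>i<n. norm (fdiff (a n) i) * norm (lam i * X i))" for n
  define p2 where "p2 n = (\<Sum>i<n. (norm (a n (i + 1)) * norm (fdiff lam i)) * norm (X i))" for n
  define p3 where "p3 n = (\<Sum>i<n. norm (A i i * a n (i + 1)) * norm (lam i * X i))" for n
  define p4 where "p4 n = \<phi> n * norm (lam n)" for n
  have nonneg: "p1 n \<ge> 0" "p2 n \<ge> 0" "p3 n \<ge> 0" "p4 n \<ge> 0" for n
    using \<phi>[of n] by (auto simp: p1_def p2_def p3_def p4_def intro!: sum_nonneg)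

  have s1: "summable (\<lambda>n. \<alpha> n * p1 n powr k)"
    unfolding p1_def
  proof (rule summable_weighted_transform[OF k \<alpha> \<phi> _ _ T1, where \<gamma> = "\<lambda>i. C3 * (\<alpha> i * \<phi> i powr k)"])
    show "summable (\<lambda>i. C3 * (\<alpha> i * \<phi> i powr k) * norm (lam i * X i) powr k)"
      using summable_mult[OF condA', of C3] by (simp add: mult_ac)
  qed (use T3 in \<open>auto simp: \<beta>_def\<close>)

  have s2: "summable (\<lambda>n. \<alpha> n * p2 n powr k)"
    unfolding p2_def
  proof (rule summable_weighted_transform[OF k \<alpha> \<phi>,
        where \<gamma> = "\<lambda>i. C4 * \<beta> i * norm (fdiff lam i)" and C = "C2 * (\<Sum>i. norm (fdiff lam i))"])
    have BV0: "summable (\<lambda>i. norm (fdiff lam i))"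
      using BV summable_Suc_iff[of "\<lambda>i. norm (fdiff lam i)"] by (simp add: bounded_variation_seq_def)
    show "(\<Sum>i<n. norm (a n (i + 1)) * norm (fdiff lam i))
        \<le> C2 * (\<Sum>i. norm (fdiff lam i)) * \<phi> n" for n
    proof -
      have "(\<Sum>i<n. norm (a n (i + 1)) * norm (fdiff lam i))
          \<le> (\<Sum>i<n. C2 * \<phi> n * norm (fdiff lam i))"
        using T2 by (intro sum_mono mult_right_mono) auto
      also have "\<dots> = C2 * \<phi> n * (\<Sum>i<n. norm (fdiff lam i))"
        by (simp add: sum_distrib_left)
      also have "\<dots> \<le> C2 * \<phi> n * (\<Sum>i. norm (fdiff lam i))"
        using C2 \<phi>[of n] by (intro mult_left_mono sum_le_suminf BV0) auto
      finally show ?thesis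
        by (simp add: mult_ac)
    qed
    fix i
    have eq: "(\<lambda>m. \<alpha> (m + i + 1) * \<phi> (m + i + 1) powr (k - 1)
          * (norm (a (m + i + 1) (i + 1)) * norm (fdiff lam i)))
        = (\<lambda>m. \<beta> (m + i + 1) * norm (a (m + i + 1) (i + 1)) * norm (fdiff lam i))"
      by (simp add: \<beta>_def mult_ac)
    show "summable (\<lambda>m. \<alpha> (m + i + 1) * \<phi> (m + i + 1) powr (k - 1)
          * (norm (a (m + i + 1) (i + 1)) * norm (fdiff lam i)))"
      unfolding eq by (intro summable_mult2 T4)
    show "(\<Sum>m. \<alpha> (m + i + 1) * \<phi> (m + i + 1) powr (k - 1)
          * (norm (a (m + i + 1) (i + 1)) * norm (fdiff lam i))) \<le> C4 * \<beta> i * norm (fdiff lam i)"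
      unfolding eq suminf_mult2[OF T4(1), symmetric]
      using T4(2)[of i] by (intro mult_right_mono) (auto simp: \<beta>_def)
  next
    show "summable (\<lambda>i. C4 * \<beta> i * norm (fdiff lam i) * norm (X i) powr k)"
      using summable_mult[OF condB, of C4] by (simp add: \<beta>_def mult_ac)
  qed auto

  have s3: "summable (\<lambda>n. \<alpha> n * p3 n powr k)"
    unfolding p3_def
  proof (rule summable_weighted_transform[OF k \<alpha> \<phi>,
        where \<gamma> = "\<lambda>i. C4 * C2 * (\<alpha> i * \<phi> i powr k)" and C = C6])
    show "(\<Sum>i<n. norm (A i i * a n (i + 1))) \<le> C6 * \<phi> n" for n
    proof -
      have "(\<Sum>i<n. norm (A i i * a n (i + 1))) \<le> (\<Sum>i=0..n. norm (A i i * a n (i + 1)))"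
        by (intro sum_mono2) auto
      then show ?thesis
        using C6[of n] by linarith
    qed
    fix i
    have eq: "(\<lambda>m. \<alpha> (m + i + 1) * \<phi> (m + i + 1) powr (k - 1) * norm (A i i * a (m + i + 1) (i + 1)))
        = (\<lambda>m. \<beta> (m + i + 1) * norm (a (m + i + 1) (i + 1)) * norm (A i i))"
      by (simp add: \<beta>_def mult_ac norm_mult)
    show "summable (\<lambda>m. \<alpha> (m + i + 1) * \<phi> (m + i + 1) powr (k - 1)
        * norm (A i i * a (m + i + 1) (i + 1)))"
      unfolding eq by (intro summable_mult2 T4)
    have "(\<Sum>m. \<beta> (m + i + 1) * norm (a (m + i + 1) (i + 1))) * norm (A i i)
        \<le> (C4 * \<beta> i) * (C2 * \<phi> i)"
      using T4(2)[of i] diag_le[of i] C4 \<beta>[of i] by (intro mult_mono) (auto simp: \<beta>_def)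
    then show "(\<Sum>m. \<alpha> (m + i + 1) * \<phi> (m + i + 1) powr (k - 1)
        * norm (A i i * a (m + i + 1) (i + 1))) \<le> C4 * C2 * (\<alpha> i * \<phi> i powr k)"
      unfolding eq suminf_mult2[OF T4(1), symmetric] \<beta>_\<phi>[symmetric] by (simp add: mult_ac)
  next
    show "summable (\<lambda>i. C4 * C2 * (\<alpha> i * \<phi> i powr k) * norm (lam i * X i) powr k)"
      using summable_mult[OF condA', of "C4 * C2"] by (simp add: mult_ac)
  qed auto

  have s4: "summable (\<lambda>n. \<alpha> n * p4 n powr k)"
  proof (rule summable_powr_dominated[OF k \<alpha>, where M = C2])
    show "summable (\<lambda>n. \<alpha> n * (\<phi> n * norm (lam n * X n)) powr k)"
      using condA' \<phi> by (simp add: powr_mult less_imp_le mult_ac)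
    show "p4 n \<le> C2 * (\<phi> n * norm (lam n * X n))" for n
      using mult_left_mono[OF X_below[of n] nonneg(4)[of n]]
      by (simp add: p4_def norm_mult mult_ac)
  qed (use nonneg C2 \<phi> in \<open>auto simp: less_imp_le\<close>)

  \<comment> \<open>One constant that dominates the factors with which \<open>p1\<close>, \<open>p2\<close>, \<open>p3\<close> and \<open>p4\<close> enter; the
    factor of \<open>p3\<close> comes from the bounds of the shifted \<open>lam\<close> and of the differences of \<open>X\<close>.\<close>
  define K where "K = max 1 (\<bar>C5\<bar> * C7)"
  have K: "K \<ge> 1" "K \<ge> \<bar>C5\<bar> * C7"
    by (auto simp: K_def)
  define q where "q n = p1 n + p2 n + p3 n + p4 n" for n
  have sq: "summable (\<lambda>n. \<alpha> n * q n powr k)"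
    unfolding q_def by (intro summable_powr_add k \<alpha> s1 s2 s3 s4 add_nonneg_nonneg nonneg)

  have term_le: "norm (fdiff (\<lambda>i. a n i * (lam i * X i)) i)
      \<le> K * (norm (fdiff (a n) i) * norm (lam i * X i)
          + (norm (a n (i + 1)) * norm (fdiff lam i)) * norm (X i)
          + norm (A i i * a n (i + 1)) * norm (lam i * X i))" if "i \<ge> 1" for n i
  proof -
    have "norm (lam (Suc i)) * norm (fdiff X i) \<le> (C5 * norm (lam i)) * (C7 * \<phi> i)"
      using C5[OF that] C7[of i] by (intro mult_mono) (auto intro: order_trans[OF norm_ge_zero])
    also have "\<dots> \<le> (\<bar>C5\<bar> * norm (lam i)) * (C7 * \<phi> i)"
      using C7_nonneg \<phi>[of i] by (intro mult_right_mono) auto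
    also have "\<dots> = (\<bar>C5\<bar> * C7) * (norm (A i i) * norm (lam i * X i))"
      by (simp add: norm_mult mult_ac flip: AX)
    also have "\<dots> \<le> K * (norm (A i i) * norm (lam i * X i))"
      using K by (intro mult_right_mono) auto
    finally have third: "norm (a n (Suc i) * lam (Suc i) * fdiff X i)
        \<le> K * (norm (A i i * a n (i + 1)) * norm (lam i * X i))"
      by (auto dest: mult_left_mono[OF _ norm_ge_zero[of "a n (Suc i)"]] simp: norm_mult mult_ac)
    have "norm (fdiff (\<lambda>i. a n i * (lam i * X i)) i)
        \<le> norm (fdiff (a n) i * (lam i * X i)) + norm (a n (Suc i) * fdiff lam i * X i)
          + norm (a n (Suc i) * lam (Suc i) * fdiff X i)"
      unfolding fdiff_triple_product by (intro norm_triangle_mono order_refl)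
    also have "\<dots> \<le> K * (norm (fdiff (a n) i) * norm (lam i * X i))
          + K * ((norm (a n (i + 1)) * norm (fdiff lam i)) * norm (X i))
          + K * (norm (A i i * a n (i + 1)) * norm (lam i * X i))"
    proof (intro add_mono third)
      have le: "y \<le> K * y" if "y \<ge> 0" for y
        using mult_right_mono[OF K(1) that] by simp
      show "norm (fdiff (a n) i * (lam i * X i)) \<le> K * (norm (fdiff (a n) i) * norm (lam i * X i))"
        using le[of "norm (fdiff (a n) i * (lam i * X i))", OF norm_ge_zero] by (simp only: norm_mult)
      show "norm (a n (Suc i) * fdiff lam i * X i)
          \<le> K * ((norm (a n (i + 1)) * norm (fdiff lam i)) * norm (X i))"
        using le[of "norm (a n (Suc i) * fdiff lam i * X i)"]
        by (simp add: norm_mult)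
    qed
    finally show ?thesis
      by (simp add: distrib_left)
  qed

  define D where "D n = norm (\<Sum>i=1..n. a n i * (u i * lam i * X i))" for n
  have D_le: "D n \<le> (M * K) * q n" for n
  proof (cases n)
    case 0
    then show ?thesis
      using nonneg[of 0] M K by (simp add: D_def q_def)
  next
    case (Suc m)
    define b where "b i = a n i * (lam i * X i)" for i
    have "D n = norm (\<Sum>i=1..n. b i * u i)"
      by (simp add: D_def b_def mult_ac)
    also have "\<dots> \<le> (\<Sum>i=1..<n. norm (fdiff b i * partial_sum u i)) + norm (b n * partial_sum u n)"
      unfolding Suc summation_by_parts
      by (intro norm_triangle_le add_mono norm_sum order_refl)
    also have "\<dots> \<le> (\<Sum>i=1..<n. M * norm (fdiff b i)) + M * (K * p4 n)"
    proof (intro add_mono sum_mono)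
      show "norm (fdiff b i * partial_sum u i) \<le> M * norm (fdiff b i)" for i
        using mult_right_mono[OF bounded[of i] norm_ge_zero[of "fdiff b i"]]
        by (simp add: norm_mult mult.commute)
      have "norm (b n) = p4 n"
        by (simp add: b_def p4_def a_def hat_mat_def norm_mult mult_ac flip: AX)
      moreover have "p4 n \<le> K * p4 n"
        using mult_right_mono[OF K(1) nonneg(4)[of n]] by simp
      ultimately show "norm (b n * partial_sum u n) \<le> M * (K * p4 n)"
        using mult_mono[OF bounded[of n] _ M norm_ge_zero[of "b n"], of "K * p4 n"]
        by (simp add: norm_mult mult.commute)
    qed
    also have "(\<Sum>i=1..<n. M * norm (fdiff b i)) \<le> M * (K * (p1 n + p2 n + p3 n))"
    proof -
      have "(\<Sum>i=1..<n. norm (fdiff b i)) \<le> (\<Sum>i=1..<n. K * (norm (fdiff (a n) i) * norm (lam i * X i)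
          + (norm (a n (i + 1)) * norm (fdiff lam i)) * norm (X i)
          + norm (A i i * a n (i + 1)) * norm (lam i * X i)))"
        using term_le unfolding b_def by (intro sum_mono) simp
      also have "\<dots> \<le> (\<Sum>i<n. K * (norm (fdiff (a n) i) * norm (lam i * X i)
          + (norm (a n (i + 1)) * norm (fdiff lam i)) * norm (X i)
          + norm (A i i * a n (i + 1)) * norm (lam i * X i)))"
        using K(1) by (intro sum_mono2) auto
      also have "\<dots> = K * (p1 n + p2 n + p3 n)"
        by (simp only: p1_def p2_def p3_def sum_distrib_left[symmetric] sum.distrib)
      finally show ?thesis
        using M by (simp add: mult_left_mono flip: sum_distrib_left)
    qed
    finally show ?thesis
      by (simp add: q_def algebra_simps)
  qed
  have "summable (\<lambda>n. \<alpha> n * D n powr k)"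
    by (rule summable_powr_dominated[OF k \<alpha> _ D_le _ _ sq])
      (use nonneg M K in \<open>auto simp: D_def q_def add_nonneg_nonneg\<close>)
  then have "summable (\<lambda>n. \<alpha> (Suc n) * D (Suc n) powr k)"
    by (subst summable_Suc_iff)
  then show ?thesis
    by (simp only: abs_matrix_summable_def matrix_mean_diff D_def a_def)
qed

section \<open>Fourier series vanishing near a point\<close>

text \<open>
  Multiplication by \<open>2 * sin (y / 2)\<close> makes the sum telescope to a difference of two sines.
\<close>

lemma cos_sum_bound:
  assumes "sin (y / 2) \<noteq> 0"
  shows "\<bar>\<Sum>v=1..n. cos (real v * y)\<bar> \<le> 1 / \<bar>sin (y / 2)\<bar>"
proof -
  have "2 * sin (y / 2) * (\<Sum>v=1..n. cos (real v * y)) = sin ((real n + 1 / 2) * y) - sin (y / 2)"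
  proof (induction n)
    case (Suc n)
    have "2 * sin (y / 2) * cos (real (Suc n) * y)
        = sin (real (Suc n) * y + y / 2) - sin (real (Suc n) * y - y / 2)"
      by (simp add: sin_add sin_diff)
    moreover have "real (Suc n) * y - y / 2 = (real n + 1 / 2) * y"
      "real (Suc n) * y + y / 2 = (real (Suc n) + 1 / 2) * y"
      by (simp_all add: algebra_simps)
    ultimately show ?case
      using Suc by (simp add: distrib_left)
  qed simp
  then have "2 * \<bar>sin (y / 2)\<bar> * \<bar>\<Sum>v=1..n. cos (real v * y)\<bar>
      = \<bar>sin ((real n + 1 / 2) * y) - sin (y / 2)\<bar>"
    by (metis abs_mult abs_numeral)
  also have "\<dots> \<le> 2"
    using abs_sin_le_one[of "(real n + 1 / 2) * y"] abs_sin_le_one[of "y / 2"] by linarith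
  finally show ?thesis
    using assms by (simp add: field_simps)
qed

text \<open>
  The zeros of \<open>sin ((t - x) / 2)\<close> are \<open>x\<close> and its translates by periods, and near these a periodic
  function that vanishes near \<open>x\<close> is zero. The bound is uniform because \<open>\<bar>sin ((t - x) / 2)\<bar>\<close> itself
  has period \<open>2 * pi\<close>, so that \<open>t\<close> may be moved to within \<open>pi\<close> of \<open>x\<close>.
\<close>

lemma sin_half_bounded_below:
  fixes h :: "real \<Rightarrow> complex"
  assumes per: "\<And>t. h (t + 2 * pi) = h t" and van: "\<forall>\<^sub>F t in nhds x. h t = 0"
  obtains s where "s > 0" "\<And>t. h t \<noteq> 0 \<Longrightarrow> s \<le> \<bar>sin ((t - x) / 2)\<bar>"
proof -
  interpret periodic_fun_simple h "2 * pi"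
    by standard (rule per)
  obtain e where e: "e > 0" "\<And>t. \<bar>t - x\<bar> < e \<Longrightarrow> h t = 0"
    using van by (auto simp: eventually_nhds_metric dist_real_def)
  \<comment> \<open>The cut at \<open>pi\<close> keeps \<open>d / 2\<close> in the range where the sine is positive and increasing.\<close>
  define d where "d = min e pi"
  have d: "0 < d" "d \<le> pi"
    using e by (auto simp: d_def)
  show thesis
  proof
    show "sin (d / 2) > 0"
      using d by (intro sin_gt_zero) auto
    fix t assume t: "h t \<noteq> 0"
    define m where "m = round ((t - x) / (2 * pi))"
    define y where "y = t - x - of_int m * (2 * pi)"
    have "\<bar>of_int m - (t - x) / (2 * pi)\<bar> \<le> 1 / 2"
      unfolding m_def by (rule of_int_round_abs_le)
    then have "\<bar>y / (2 * pi)\<bar> \<le> 1 / 2"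
      by (simp add: y_def diff_divide_distrib abs_minus_commute)
    then have y_le: "\<bar>y\<bar> \<le> pi"
      by (simp add: field_simps)
    have "h (x + y) \<noteq> 0"
      using t minus_of_int[of t m] by (simp add: y_def)
    then have "\<bar>y\<bar> \<ge> d"
      using e(2)[of "x + y"] by (force simp: d_def)
    then have "sin (d / 2) \<le> sin (\<bar>y\<bar> / 2)"
      using y_le d by (intro sin_monotone_2pi_le) auto
    also have "\<dots> \<le> \<bar>sin (y / 2)\<bar>"
      by (cases "y \<ge> 0") auto
    also have "\<dots> = \<bar>sin ((t - x) / 2)\<bar>"
    proof -
      have "(t - x) / 2 = y / 2 + pi * of_int m"
        by (simp add: y_def diff_divide_distrib)
      moreover have "\<bar>cos (pi * of_int m)\<bar> = 1"
        using sin_cos_squared_add[of "pi * of_int m"] by (simp add: power2_eq_1_iff abs_if)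
      ultimately show ?thesis
        by (simp only: sin_add abs_mult sin_npi_int mult_zero_right add_0_right mult_1_right)
    qed
    finally show "sin (d / 2) \<le> \<bar>sin ((t - x) / 2)\<bar>" .
  qed
qed

lemma set_integrable_mult_bounded_continuous:
  fixes h :: "real \<Rightarrow> complex" and g :: "real \<Rightarrow> real"
  assumes h: "set_integrable lebesgue S h"
    and g: "continuous_on UNIV g" "\<And>t. \<bar>g t\<bar> \<le> B"
  shows "set_integrable lebesgue S (\<lambda>t. h t * complex_of_real (g t))"
proof -
  have [measurable]: "g \<in> borel_measurable lebesgue"
    using borel_measurable_continuous_onI[OF g(1)] by (simp add: measurable_completion)
  have [measurable]: "(\<lambda>t. indicator S t *\<^sub>R h t) \<in> borel_measurable lebesgue"
    using h by (auto simp: set_integrable_def)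
  have "integrable lebesgue (\<lambda>t. (indicator S t *\<^sub>R h t) * complex_of_real (g t))"
  proof (rule Bochner_Integration.integrable_bound)
    show "integrable lebesgue (\<lambda>t. B *\<^sub>R (indicator S t *\<^sub>R h t))"
      using h by (intro integrable_scaleR_right) (simp add: set_integrable_def)
    show "AE t in lebesgue. norm ((indicator S t *\<^sub>R h t) * complex_of_real (g t))
        \<le> norm (B *\<^sub>R (indicator S t *\<^sub>R h t))"
    proof (intro AE_I2)
      fix t
      show "norm ((indicator S t *\<^sub>R h t) * complex_of_real (g t)) \<le> norm (B *\<^sub>R (indicator S t *\<^sub>R h t))"
        using mult_right_mono[OF order_trans[OF g(2)[of t] abs_ge_self] norm_ge_zero[of "indicator S t *\<^sub>R h t"]]
        by (simp add: norm_mult abs_mult mult_ac)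
    qed
  qed measurable
  then show ?thesis
    by (simp add: set_integrable_def)
qed

lemma set_integrable_mult_trig:
  assumes "set_integrable lebesgue S (h :: real \<Rightarrow> complex)"
  shows "set_integrable lebesgue S (\<lambda>t. h t * complex_of_real (cos (c * t)))"
    and "set_integrable lebesgue S (\<lambda>t. h t * complex_of_real (sin (c * t)))"
    and "set_integrable lebesgue S (\<lambda>t. h t * complex_of_real (cos (c * (t - x))))"
  by (rule set_integrable_mult_bounded_continuous[OF assms, where B = 1];
      auto intro!: continuous_intros)+

lemma fourier_term_convolution:
  assumes h: "set_integrable lebesgue {-pi<..<pi} h"
  shows "fourier_term h n x
    = (LINT t:{-pi<..<pi}|lebesgue. h t * complex_of_real (cos (real n * (t - x)))) / complex_of_real pi"
proof -
  note trig = set_integrable_mult_trig(1,2)[OF h, of "real n"]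
  have "(LINT t:{-pi<..<pi}|lebesgue. h t * complex_of_real (cos (real n * (t - x))))
      = (LINT t:{-pi<..<pi}|lebesgue. h t * complex_of_real (cos (real n * t)) * complex_of_real (cos (real n * x))
          + h t * complex_of_real (sin (real n * t)) * complex_of_real (sin (real n * x)))"
    by (simp add: right_diff_distrib cos_diff algebra_simps)
  also have "\<dots> = (LINT t:{-pi<..<pi}|lebesgue. h t * complex_of_real (cos (real n * t))) * complex_of_real (cos (real n * x))
        + (LINT t:{-pi<..<pi}|lebesgue. h t * complex_of_real (sin (real n * t))) * complex_of_real (sin (real n * x))"
    using trig by (subst set_integral_add) auto
  finally show ?thesis
    by (simp add: fourier_term_def fourier_cos_coeff_def fourier_sin_coeff_def add_divide_distrib)
qed

lemma fourier_term_diff: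
  assumes "set_integrable lebesgue {-pi<..<pi} f" "set_integrable lebesgue {-pi<..<pi} g"
  shows "fourier_term (\<lambda>t. f t - g t) n x = fourier_term f n x - fourier_term g n x"
  using assms set_integrable_mult_trig(3)[OF assms(1), of "real n" x]
    set_integrable_mult_trig(3)[OF assms(2), of "real n" x]
  by (simp add: fourier_term_convolution set_integral_diff left_diff_distrib diff_divide_distrib)

lemma partial_sum_fourier_term:
  assumes h: "set_integrable lebesgue {-pi<..<pi} h"
  shows "partial_sum (\<lambda>m. fourier_term h m x) n
    = (LINT t:{-pi<..<pi}|lebesgue. h t * complex_of_real (\<Sum>v=1..n. cos (real v * (t - x)))) / complex_of_real pi"
proof -
  have "(LINT t:{-pi<..<pi}|lebesgue. h t * complex_of_real (\<Sum>v=1..n. cos (real v * (t - x))))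
      = (\<Sum>v=1..n. LINT t:{-pi<..<pi}|lebesgue. h t * complex_of_real (cos (real v * (t - x))))"
    using set_integrable_mult_trig(3)[OF h, of _ x]
    unfolding set_lebesgue_integral_def set_integrable_def
    by (subst Bochner_Integration.integral_sum[symmetric])
      (auto simp: sum_distrib_left scaleR_sum_right)
  then show ?thesis
    by (simp add: partial_sum_def fourier_term_convolution[OF h] sum_divide_distrib)
qed

text \<open>
  The integrand vanishes wherever the cosine sums are not bounded uniformly in \<open>n\<close>, so a fixed
  multiple of \<open>\<bar>h\<bar>\<close> dominates it for all \<open>n\<close>.
\<close>

lemma fourier_partial_sums_bounded:
  assumes h: "set_integrable lebesgue {-pi<..<pi} h"
    and per: "\<And>t. h (t + 2 * pi) = h t" and van: "\<forall>\<^sub>F t in nhds x. h t = 0"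
  obtains M where "\<And>n. norm (partial_sum (\<lambda>m. fourier_term h m x) n) \<le> M"
proof -
  let ?S = "{-pi<..<pi}"
  obtain s where s: "s > 0" "\<And>t. h t \<noteq> 0 \<Longrightarrow> s \<le> \<bar>sin ((t - x) / 2)\<bar>"
    using sin_half_bounded_below[OF per van] by blast
  let ?H = "\<lambda>t. norm (indicator ?S t *\<^sub>R h t) / s"
  have H: "integrable lebesgue ?H"
    using h unfolding set_integrable_def by (intro integrable_divide integrable_norm)
  have bound: "norm (LINT t:?S|lebesgue. h t * complex_of_real (\<Sum>v=1..n. cos (real v * (t - x))))
      \<le> integral\<^sup>L lebesgue ?H" for n
    unfolding set_lebesgue_integral_def
  proof (rule Bochner_Integration.integral_norm_bound_integral[OF _ H])
    show "integrable lebesgue (\<lambda>t. indicator ?S t *\<^sub>R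
        (h t * complex_of_real (\<Sum>v=1..n. cos (real v * (t - x)))))"
      using set_integrable_mult_trig(3)[OF h, of _ x]
      unfolding set_integrable_def of_real_sum sum_distrib_left scaleR_sum_right
      by (intro Bochner_Integration.integrable_sum) auto
    fix t
    show "norm (indicator ?S t *\<^sub>R (h t * complex_of_real (\<Sum>v=1..n. cos (real v * (t - x))))) \<le> ?H t"
    proof (cases "h t = 0")
      case False
      have "\<bar>\<Sum>v=1..n. cos (real v * (t - x))\<bar> \<le> 1 / \<bar>sin ((t - x) / 2)\<bar>"
        using s(2)[OF False] s(1) by (intro cos_sum_bound) auto
      also have "\<dots> \<le> 1 / s"
        using s(2)[OF False] s(1) by (intro divide_left_mono) auto
      finally have "norm (indicator ?S t *\<^sub>R h t) * \<bar>\<Sum>v=1..n. cos (real v * (t - x))\<bar>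
          \<le> norm (indicator ?S t *\<^sub>R h t) * (1 / s)"
        by (intro mult_left_mono) auto
      then show ?thesis
        by (simp add: norm_mult mult.assoc del: of_real_sum)
    qed simp
  qed
  show thesis
  proof (rule that)
    show "norm (partial_sum (\<lambda>m. fourier_term h m x) n) \<le> integral\<^sup>L lebesgue ?H / pi" for n
      unfolding partial_sum_fourier_term[OF h] norm_divide
      using divide_right_mono[OF bound[of n] pi_ge_zero] by (simp only: norm_of_real abs_of_nonneg pi_ge_zero)
  qed
qed

section \<open>Localisation\<close>

theorem theorem1:
  fixes k :: real
    and \<alpha> \<phi> :: "nat \<Rightarrow> real"
    and A :: "nat \<Rightarrow> nat \<Rightarrow> complex"
    and X lam :: "nat \<Rightarrow> complex"
  assumes "k \<ge> 1"
    and "\<And>n. \<alpha> n > 0"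
    and "\<And>n. \<phi> n > 0"
    and "lower_triangular A"
    and "\<And>n. A n n \<noteq> 0"
    and "A \<in> class_S k \<alpha> \<phi>"
    and "\<And>n. X n = complex_of_real (\<phi> n) / A n n"
    and "bounded_variation_seq lam"
    and "\<exists>C. \<forall>n\<ge>1. norm (lam (n + 1)) \<le> C * norm (lam n)"
    and "summable (\<lambda>n. \<alpha> n * \<phi> n powr k * norm (X n) powr k * norm (lam n) powr k)"
    and "summable (\<lambda>n. \<alpha> n * \<phi> n powr (k - 1) * norm (X n) powr k * norm (fdiff lam n))"
    and "\<exists>C. \<forall>n. (\<Sum>v=0..n. norm (A v v * hat_mat A n (v + 1))) \<le> C * \<phi> n"
    and "\<exists>C. \<forall>n. norm (fdiff X n) \<le> C * \<phi> n"
  shows "\<forall>x. local_property_at x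
           (\<lambda>f. abs_matrix_summable A \<alpha> k (\<lambda>n. fourier_term f n x * lam n * X n))"
proof (intro allI)
  fix x
  let ?P = "\<lambda>f. abs_matrix_summable A \<alpha> k (\<lambda>n. fourier_term f n x * lam n * X n)"
  have transfer: "?P g"
    if f: "admissible f" and g: "admissible g" and eq: "\<forall>\<^sub>F t in nhds x. f t = g t" and Pf: "?P f"
    for f g
  proof -
    let ?h = "\<lambda>t. f t - g t"
    have int: "set_integrable lebesgue {-pi<..<pi} f" "set_integrable lebesgue {-pi<..<pi} g"
      using f g by (auto simp: admissible_def)
    have int_h: "set_integrable lebesgue {-pi<..<pi} ?h"
      using int by (rule set_integral_diff)
    have per_h: "?h (t + 2 * pi) = ?h t" for t
      using f g by (simp add: admissible_def)
    have "\<forall>\<^sub>F t in nhds x. ?h t = 0"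
      using eq by (auto elim: eventually_mono)
    then obtain M where M: "\<And>n. norm (partial_sum (\<lambda>m. fourier_term ?h m x) n) \<le> M"
      using fourier_partial_sums_bounded[OF int_h per_h] by blast
    have Ph: "?P ?h"
      by (rule abs_matrix_summable_of_bounded_partial_sums[OF assms(1-3,5-13) M])
    have "(\<lambda>n. fourier_term f n x * lam n * X n - fourier_term ?h n x * lam n * X n)
        = (\<lambda>n. fourier_term g n x * lam n * X n)"
      unfolding fourier_term_diff[OF int] by (simp add: algebra_simps)
    then show ?thesis
      using abs_matrix_summable_diff[OF assms(1,2) Pf Ph] by simp
  qed
  show "local_property_at x ?P"
    unfolding local_property_at_def
  proof (intro allI impI)
    fix f g
    assume fg: "admissible f \<and> admissible g \<and> (\<forall>\<^sub>F t in nhds x. f t = g t)"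
    then have "\<forall>\<^sub>F t in nhds x. g t = f t"
      by (auto elim: eventually_mono)
    then show "?P f \<longleftrightarrow> ?P g"
      using transfer[of f g] transfer[of g f] fg by blast
  qed
qed

end
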